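(* Let $R$ be a unital $*$-ring and let $a,b,x\in R$ with $xa=bx$ and $xa^*=b^*x$. If $a$ and $b$ are core invertible, then $xa^{(\#)}=b^{(\#)}x$.
   Context: A unital $*$-ring is an associative (not necessarily commutative) ring $R$ with unity $1$ and an involution $a\mapsto a^*$ satisfying $(a^* )^*=a$, $(a+b)^*=a^*+b^*$, $(ab)^*=b^*a^*$ for all $a,b\in R$. An element $a\in R$ is core invertible if there exists $y\in R$ such that $aya=a$, $yR=aR$ and $Ry=Ra^*$; such $y$ is unique if it exists, is called the core inverse of $a$, and is denoted by $a^{(\#)}$. *)

theory Defs
  imports Main
begin

text \<open>The combination of \<^class>\<open>ring\<close> and \<^class>\<open>monoid_mult\<close> is used instead of
  \<^class>\<open>ring_1\<close>, since the latter additionally imposes \<open>0 \<noteq> 1\<close> and so excludes the zero ring.\<close>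

class star_ring_1 = ring + monoid_mult +
  fixes star :: "'a \<Rightarrow> 'a"
  assumes star_star: "star (star a) = a"
    and star_add: "star (a + b) = star a + star b"
    and star_mult: "star (a * b) = star b * star a"

definition right_principal :: "'a::star_ring_1 \<Rightarrow> 'a set"
  where "right_principal a = {a * r |r. True}"

definition left_principal :: "'a::star_ring_1 \<Rightarrow> 'a set"
  where "left_principal a = {r * a |r. True}"

definition is_core_inverse :: "'a::star_ring_1 \<Rightarrow> 'a \<Rightarrow> bool"
  where "is_core_inverse a y \<longleftrightarrow>
    a * y * a = a \<and>
    right_principal y = right_principal a \<and>
    left_principal y = left_principal (star a)"

definition core_invertible :: "'a::star_ring_1 \<Rightarrow> bool"
  where "core_invertible a \<longleftrightarrow> (\<exists>y. is_core_inverse a y)"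

text \<open>Meaningful only for core invertible elements; see \<open>is_core_inverse_unique\<close> below.\<close>

definition core_inverse :: "'a::star_ring_1 \<Rightarrow> 'a"
  where "core_inverse a = (THE y. is_core_inverse a y)"

lemma is_core_inverse_star_absorb:
  assumes "is_core_inverse a y" "z \<in> left_principal (star a)"
  shows "z * star (a * y) = z"
proof -
  obtain w where w: "z = w * star a"
    using assms(2) by (auto simp: left_principal_def)
  have "star (a * y * a) = star a"
    using assms(1) by (simp add: is_core_inverse_def)
  then have "star a * star (a * y) = star a"
    by (simp add: star_mult mult.assoc)
  then show ?thesis
    by (simp add: w mult.assoc)
qed

lemma is_core_inverse_mem:
  assumes "is_core_inverse a y"
  shows "y \<in> left_principal (star a)" "y \<in> right_principal a" "a \<in> right_principal y"
proof -
  have "y \<in> left_principal y"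
    unfolding left_principal_def by (auto intro: exI[of _ 1])
  then show "y \<in> left_principal (star a)"
    using assms by (simp add: is_core_inverse_def)
  have self: "c \<in> right_principal c" for c :: 'a
    unfolding right_principal_def by (auto intro: exI[of _ 1])
  show "y \<in> right_principal a" "a \<in> right_principal y"
    using assms self[of y] self[of a] by (simp_all add: is_core_inverse_def)
qed

lemma is_core_inverse_star:
  assumes "is_core_inverse a y"
  shows "star (a * y) = a * y"
proof -
  have "y * star (a * y) = y"
    using is_core_inverse_star_absorb[OF assms] is_core_inverse_mem[OF assms] by blast
  then have eq: "(a * y) * star (a * y) = a * y"
    by (simp add: mult.assoc)
  have "star ((a * y) * star (a * y)) = (a * y) * star (a * y)"
    by (simp add: star_mult star_star)
  then show ?thesis
    by (simp add: eq)
qed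

lemma is_core_inverse_unique:
  assumes y: "is_core_inverse a y" and z: "is_core_inverse a z"
  shows "y = z"
proof -
  have zay: "z * (a * y) = z"
    using is_core_inverse_star_absorb[OF y is_core_inverse_mem(1)[OF z]]
    by (simp add: is_core_inverse_star[OF y])
  have "z * (a * z) = z"
    using is_core_inverse_star_absorb[OF z is_core_inverse_mem(1)[OF z]]
    by (simp add: is_core_inverse_star[OF z])
  moreover obtain t where t: "a = z * t"
    using is_core_inverse_mem(3)[OF z] by (auto simp: right_principal_def)
  ultimately have "z * (a * a) = a"
    by (metis mult.assoc)
  moreover obtain u where "y = a * u"
    using is_core_inverse_mem(2)[OF y] by (auto simp: right_principal_def)
  ultimately have "z * (a * y) = y"
    by (metis mult.assoc)
  with zay show ?thesis
    by simp
qed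

lemma core_inverse_eqI: "is_core_inverse a y \<Longrightarrow> core_inverse a = y"
  unfolding core_inverse_def by (blast intro: is_core_inverse_unique)

end

theory Submission
  imports Defs
begin

text \<open>Write \<open>y\<close> and \<open>z\<close> for the core inverses of \<open>a\<close> and \<open>b\<close>. The products \<open>a * y\<close> and
  \<open>b * z\<close> are self-adjoint idempotents, the projections onto \<open>a R\<close> and \<open>b R\<close>. The relation
  \<open>x * a = b * x\<close> says that \<open>x\<close> carries the range of \<open>a\<close> into that of \<open>b\<close>; the relation
  between the adjoints says the same for the complementary parts, which the two adjoints
  annihilate. Hence \<open>x\<close> intertwines the two projections:
  \<open>x * (a * y) = (b * z) * x\<close>. On the range of \<open>a\<close>, the element \<open>y\<close> inverts \<open>a\<close>, and likewise
  for \<open>z\<close> and \<open>b\<close>, so that \<open>x * y\<close> and \<open>z * x\<close> agree after multiplication by the projection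
  \<open>a * y\<close> on the right. Both products absorb this projection, the second one because it can
  be moved past \<open>x\<close>.\<close>

lemma core_invertible_is_core_inverse:
  "core_invertible a \<Longrightarrow> is_core_inverse a (core_inverse a)"
  unfolding core_invertible_def using core_inverse_eqI by blast

lemma is_core_inverse_outer:
  assumes "is_core_inverse a y"
  shows "y * (a * y) = y"
  using is_core_inverse_star_absorb[OF assms is_core_inverse_mem(1)[OF assms]]
  by (simp add: is_core_inverse_star[OF assms])

lemma is_core_inverse_adjoint_absorb:
  assumes "is_core_inverse a y"
  shows "star a * (a * y) = star a"
proof -
  have "star a \<in> left_principal (star a)"
    unfolding left_principal_def by (auto intro: exI[of _ 1])
  from is_core_inverse_star_absorb[OF assms this] show ?thesis
    by (simp add: is_core_inverse_star[OF assms])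
qed

text \<open>Since \<open>y\<close> lies in \<open>a R\<close>, the idempotent \<open>a * y\<close> fixes it from the left.\<close>

lemma is_core_inverse_left_absorb:
  assumes "is_core_inverse a y"
  shows "a * (y * y) = y"
proof -
  obtain u where u: "y = a * u"
    using is_core_inverse_mem(2)[OF assms] by (auto simp: right_principal_def)
  have "a * y * a = a"
    using assms by (simp add: is_core_inverse_def)
  then have "a * y * (a * u) = a * u"
    by (simp add: mult.assoc[symmetric])
  then show ?thesis
    by (simp add: u[symmetric] mult.assoc)
qed

text \<open>Since \<open>a\<close> lies in \<open>y R\<close>, the idempotent \<open>y * a\<close> fixes it from the left.\<close>

lemma is_core_inverse_cancel_square:
  assumes "is_core_inverse a y"
  shows "y * (a * a) = a"
proof -
  obtain t where t: "a = y * t"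
    using is_core_inverse_mem(3)[OF assms] by (auto simp: right_principal_def)
  have "y * (a * y) * t = y * t"
    by (simp add: is_core_inverse_outer[OF assms])
  then show ?thesis
    by (simp add: mult.assoc t[symmetric])
qed

text \<open>Both sides equal the compression \<open>(b * z) * x * (a * y)\<close>. The left side does because
  \<open>x * a = b * x\<close> has its values in \<open>b R\<close>; the right side because \<open>z\<close> is a left multiple
  of \<open>star b\<close>, which \<open>x\<close> turns into \<open>star a\<close>.\<close>

lemma core_projection_intertwine:
  fixes a b x :: "'a::star_ring_1"
  assumes xa: "x * a = b * x" and xs: "x * star a = star b * x"
    and y: "is_core_inverse a y" and z: "is_core_inverse b z"
  shows "x * (a * y) = b * z * x"
proof -
  have bzb: "b * z * b = b"
    using z by (simp add: is_core_inverse_def)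
  have "x * (a * y) = b * z * b * (x * y)"
    by (simp add: bzb xa mult.assoc[symmetric])
  also have "\<dots> = b * z * (x * (a * y))"
    by (simp add: xa mult.assoc[symmetric])
  finally have left: "x * (a * y) = b * z * (x * (a * y))" .
  obtain w where w: "z = w * star b"
    using is_core_inverse_mem(1)[OF z] by (auto simp: left_principal_def)
  have bzx: "b * z * x = b * w * x * star a"
    by (simp add: w mult.assoc xs)
  have "b * z * x * (a * y) = b * w * x * (star a * (a * y))"
    by (simp only: bzx mult.assoc[of _ "star a"])
  also have "\<dots> = b * z * x"
    by (simp only: is_core_inverse_adjoint_absorb[OF y] bzx)
  finally show ?thesis
    using left by (simp add: mult.assoc)
qed

theorem theorem3p2:
  fixes a b x :: "'a::star_ring_1"
  assumes "x * a = b * x"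
    and "x * star a = star b * x"
    and "core_invertible a"
    and "core_invertible b"
  shows "x * core_inverse a = core_inverse b * x"
proof -
  define y z where "y = core_inverse a" and "z = core_inverse b"
  have y: "is_core_inverse a y" and z: "is_core_inverse b z"
    unfolding y_def z_def using assms(3,4) by (simp_all add: core_invertible_is_core_inverse)
  \<comment> \<open>Splitting \<open>y\<close> as \<open>a * (y * y)\<close> provides, after moving \<open>x\<close> past \<open>a\<close>,
    the second factor \<open>b\<close> that \<open>z\<close> needs in order to cancel the first one.\<close>
  have xy: "x * y = b * (x * (y * y))"
    using assms(1) is_core_inverse_left_absorb[OF y] by (metis mult.assoc)
  have "z * (x * (a * y)) = z * (b * (x * y))"
    using assms(1) by (metis mult.assoc)
  also have "\<dots> = z * (b * b) * (x * (y * y))"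
    by (simp add: xy mult.assoc)
  also have "\<dots> = x * y"
    by (simp only: is_core_inverse_cancel_square[OF z] xy)
  finally have "x * y = z * (x * (a * y))" by simp
  also have "\<dots> = z * (b * z) * x"
    by (simp add: core_projection_intertwine[OF assms(1,2) y z] mult.assoc)
  also have "\<dots> = z * x"
    by (simp only: is_core_inverse_outer[OF z])
  finally show ?thesis
    by (simp add: y_def z_def)
qed

end
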